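(* For any integers $n\ge1$ and $k\ge0$, $$a_3\bigl(3n^2+(3^{k+1}+2)n+3^k\bigr)=a_3(n)\,a_3(n+3^k).$$
   Context: $a_3(n)$ denotes the number of $3$-core partitions of $n$, i.e. integer partitions of $n$ whose Young diagram has no hook of length $3$ (the hook of a box $b$ consists of $b$, the boxes to its right in its row and the boxes below it in its column; its hooklength is its number of boxes). *)

theory Defs
  imports Main
begin

text \<open>Partitions are weakly decreasing lists of positive parts. Boxes of a Young diagram are
  pairs \<open>(i, j)\<close> of row and column index, counted from 0 (English notation).\<close>

definition partition_of :: "nat \<Rightarrow> nat list \<Rightarrow> bool" where
  "partition_of n p \<longleftrightarrow> sorted_wrt (\<ge>) p \<and> 0 \<notin> set p \<and> sum_list p = n"

definition young_diagram :: "nat list \<Rightarrow> (nat \<times> nat) set" where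
  "young_diagram p = {(i, j). i < length p \<and> j < p ! i}"

fun hook :: "nat list \<Rightarrow> nat \<times> nat \<Rightarrow> (nat \<times> nat) set" where
  "hook p (i, j) = {(i', j') \<in> young_diagram p. (i' = i \<and> j \<le> j') \<or> (j' = j \<and> i \<le> i')}"

definition hook_length :: "nat list \<Rightarrow> nat \<times> nat \<Rightarrow> nat" where
  "hook_length p b = card (hook p b)"

definition is_core :: "nat \<Rightarrow> nat list \<Rightarrow> bool" where
  "is_core t p \<longleftrightarrow> (\<forall>b \<in> young_diagram p. hook_length p b \<noteq> t)"

definition num_cores :: "nat \<Rightarrow> nat \<Rightarrow> nat" where
  "num_cores t n = card {p. partition_of n p \<and> is_core t p}"

lemma finite_young_diagram: "finite (young_diagram p)"
proof (rule finite_subset)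
  show "young_diagram p \<subseteq> (SIGMA i : {..<length p}. {..<p ! i})"
    by (auto simp: young_diagram_def)
qed auto

lemma finite_partitions: "finite {p. partition_of n p}"
proof (rule finite_subset)
  have "length p \<le> sum_list p" if "0 \<notin> set p" for p :: "nat list"
    using that by (induction p) auto
  then show "{p. partition_of n p} \<subseteq> {p. set p \<subseteq> {..n} \<and> length p \<le> n}"
    by (auto simp: partition_of_def intro: member_le_sum_list)
  show "finite {p :: nat list. set p \<subseteq> {..n} \<and> length p \<le> n}"
    by (rule finite_lists_length_le) simp
qed

end

theory Submission
  imports Defs "HOL-Number_Theory.Cong"
begin

text \<open>Write \<open>N\<close> for the argument on the left-hand side. Then
  \<open>3 N + 1 = (3 n + 1) (3 (n + 3 ^ k) + 1)\<close>, and the two factors are coprime because they differ by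
  a power of 3 and are prime to 3. So the theorem says that \<open>a\<^sub>3(n)\<close>, regarded as a function of
  \<open>3 n + 1\<close>, is multiplicative on this factorization. The reason is that \<open>a\<^sub>3(n)\<close> counts the ideals of
  norm \<open>3 n + 1\<close> in the ring of Eisenstein integers \<open>x + y \<omega>\<close>, \<open>\<omega>\<^sup>2 + \<omega> + 1 = 0\<close>. An ideal of norm
  prime to 3 is principal and has exactly one generator congruent to 1 modulo 3, called primary, so
  that the ideals can be replaced by primary elements.

  From cores to Eisenstein integers: a partition is determined by the set of hook lengths of its
  first column, and the partition is a 3-core iff this set is closed under subtraction of 3
  (\<open>is_core_iff_beta_set\<close>). Such a set consists of \<open>a\<close> numbers in the class 1 and \<open>b\<close> numbers in the
  class 2 modulo 3, an initial segment of each class, and the size of the partition is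
  \<open>a\<^sup>2 - a b + b\<^sup>2 + b\<close> (\<open>num_cores_3\<close>). Three times this number plus 1 is the norm of
  \<open>1 - \<omega> (1 - \<omega>) (a + b \<omega>)\<close>. For natural \<open>a\<close>, \<open>b\<close> these elements fill one third of the plane, a
  fundamental domain for multiplication by \<open>\<omega>\<close> on the elements congruent to 1 modulo \<open>1 - \<omega>\<close>; the
  primary elements are another set of representatives for the same action, which gives the
  bijection \<open>bij_primary_of_pair\<close>.

  Multiplicativity (\<open>card_primaries_mult\<close>): for coprime positive \<open>m\<close> and \<open>m'\<close>,
  multiplication is a bijection from pairs of primary elements of norms \<open>m\<close> and \<open>m'\<close> to primary elements of norm \<open>m m'\<close>. Division
  with remainder makes every ideal with two generators principal, and a generator of the ideal
  \<open>(\<gamma>, m)\<close> is the factor of norm \<open>m\<close> of \<open>\<gamma>\<close>.\<close>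

section \<open>First column hook lengths and cores\<close>

text \<open>For a weakly decreasing list of positive parts this is the set of hook lengths of the boxes in the
  first column. Recursion on the list builds the diagram from the bottom row upwards.\<close>

fun beta_set :: "nat list \<Rightarrow> nat set" where
  "beta_set [] = {}"
| "beta_set (a # q) = insert (a + length q) (beta_set q)"

lemma young_diagram_Cons:
  "(0, j) \<in> young_diagram (a # q) \<longleftrightarrow> j < a"
  "(Suc i, j) \<in> young_diagram (a # q) \<longleftrightarrow> (i, j) \<in> young_diagram q"
  by (simp_all add: young_diagram_def)

lemma hook_length_Cons_Suc: "hook_length (a # q) (Suc i, j) = hook_length q (i, j)"
proof -
  have "b \<in> hook (a # q) (Suc i, j) \<longleftrightarrow> b \<in> map_prod Suc id ` hook q (i, j)" for b
  proof -
    obtain k l where b: "b = (k, l)" by (cases b)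
    show ?thesis unfolding b by (cases k) (force simp: young_diagram_Cons)+
  qed
  then have "hook (a # q) (Suc i, j) = map_prod Suc id ` hook q (i, j)"
    by blast
  moreover have "inj_on (map_prod Suc (id :: nat \<Rightarrow> nat)) A" for A
    by (auto simp: inj_on_def)
  ultimately show ?thesis
    by (simp add: hook_length_def card_image)
qed

lemma hook_length_Cons_0:
  assumes "j < a"
  shows "hook_length (a # q) (0, j) = (a - j) + length (filter (\<lambda>b. j < b) q)"
proof -
  let ?leg = "{i. i < length q \<and> j < q ! i}"
  have "b \<in> hook (a # q) (0, j) \<longleftrightarrow> b \<in> Pair 0 ` {j..<a} \<union> (\<lambda>i. (Suc i, j)) ` ?leg" for b
  proof -
    obtain k l where b: "b = (k, l)" by (cases b)
    show ?thesis using assms unfolding b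
      by (cases k) (auto simp: young_diagram_Cons, auto simp: young_diagram_def)
  qed
  then have "hook (a # q) (0, j) = Pair 0 ` {j..<a} \<union> (\<lambda>i. (Suc i, j)) ` ?leg"
    by blast
  moreover have "card (\<dots>) = card {j..<a} + card ?leg"
    by (subst card_Un_disjoint) (auto simp: card_image inj_on_def)
  ultimately show ?thesis
    by (simp add: hook_length_def length_filter_conv_card)
qed

text \<open>Arms extend to the right and legs extend downwards, so that a new top row leaves the hooks of the
  other rows as they are. This is what makes induction on the list of parts possible.\<close>

lemma is_core_Cons:
  "is_core t (a # q) \<longleftrightarrow>
    is_core t q \<and> (\<forall>j<a. (a - j) + length (filter (\<lambda>b. j < b) q) \<noteq> t)"
proof -
  have split_first_row: "(\<forall>i. P i) \<longleftrightarrow> P 0 \<and> (\<forall>i. P (Suc i))" for P :: "nat \<Rightarrow> bool"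
    by (metis not0_implies_Suc)
  have core: "is_core t p \<longleftrightarrow> (\<forall>i j. (i, j) \<in> young_diagram p \<longrightarrow> hook_length p (i, j) \<noteq> t)" for p
    by (auto simp: is_core_def)
  show ?thesis
    unfolding core split_first_row[of "\<lambda>i. \<forall>j. (i, j) \<in> young_diagram (a # q) \<longrightarrow> _ i j"]
      young_diagram_Cons hook_length_Cons_Suc
    using hook_length_Cons_0[of _ a q] by auto
qed

text \<open>The number \<open>j + #{b \<in> q. b \<le> j}\<close> is the position of the \<open>j\<close>-th gap of the beta-set; in the
  boundary path of the diagram, gaps are the horizontal and beta-numbers the vertical steps. A new
  largest part \<open>b\<close> fills the gap at \<open>b + length q\<close>, and the gaps above it are renumbered.\<close>

lemma range_gaps:
  assumes "sorted_wrt (\<ge>) q"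
  shows "range (\<lambda>j. j + length (filter (\<lambda>b. b \<le> j) q)) = - beta_set q"
  using assms
proof (induction q)
  case (Cons b q)
  let ?g = "\<lambda>q j. j + length (filter (\<lambda>b. b \<le> j) q)"
  have le: "?g q j \<le> j + length q" for j
    by simp
  have eq: "?g q j = j + length q" if "b \<le> j" for j
  proof -
    have "filter (\<lambda>b. b \<le> j) q = q"
      using Cons.prems that by (intro filter_True) auto
    then show ?thesis by simp
  qed
  have "range (?g (b # q)) = range (?g q) - {b + length q}"
  proof (intro equalityI subsetI)
    fix y assume "y \<in> range (?g (b # q))"
    then obtain j where j: "y = ?g (b # q) j" by blast
    show "y \<in> range (?g q) - {b + length q}"
    proof (cases "b \<le> j")
      case True
      then have "y = Suc j + length q" using j eq[of j] by simp
      moreover have "?g q (Suc j) = Suc j + length q" using True by (intro eq) simp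
      ultimately have "y = ?g q (Suc j)" "y \<noteq> b + length q" using True by simp_all
      then show ?thesis by blast
    next
      case False
      then have "y = ?g q j" using j by simp
      moreover from this have "y \<noteq> b + length q" using False le[of j] by linarith
      ultimately show ?thesis by blast
    qed
  next
    fix y assume "y \<in> range (?g q) - {b + length q}"
    then obtain j where j: "y = ?g q j" "y \<noteq> b + length q" by blast
    show "y \<in> range (?g (b # q))"
    proof (cases "b < j")
      case True
      then obtain i where i: "j = Suc i" "b \<le> i" by (cases j) auto
      then have "y = ?g (b # q) i" using j eq[of i] eq[of j] by simp
      then show ?thesis by blast
    next
      case False
      with j eq[of j] have "j < b" by (cases "j = b") auto
      then have "y = ?g (b # q) j" using j by simp
      then show ?thesis by blast
    qed
  qed
  also have "range (?g q) = - beta_set q" using Cons by simp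
  finally show ?case by auto
qed auto

lemma beta_set_less:
  assumes "sorted_wrt (\<ge>) (a # q)" "x \<in> beta_set q"
  shows "x < a + length q"
  using assms
proof (induction q arbitrary: a)
  case (Cons b q)
  have "x \<le> b + length q"
  proof (cases "x = b + length q")
    case False
    then have "x \<in> beta_set q" using Cons.prems by simp
    moreover have "sorted_wrt (\<ge>) (b # q)" using Cons.prems by simp
    ultimately show ?thesis using Cons.IH[of b] by simp
  qed simp
  then show ?case using Cons.prems by simp
qed simp

text \<open>By \<open>range_gaps\<close>, the hook lengths in the row with beta-number \<open>x\<close> are the distances from \<open>x\<close> down
  to the gaps below it. So a hook of length \<open>t\<close> is a beta-number \<open>x\<close> such that \<open>x - t\<close> is a gap.\<close>

lemma is_core_iff_beta_set:
  assumes "sorted_wrt (\<ge>) p" "t > 0"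
  shows "is_core t p \<longleftrightarrow> (\<forall>x \<in> beta_set p. t \<le> x \<longrightarrow> x - t \<in> beta_set p)"
  using assms(1)
proof (induction p)
  case Nil
  then show ?case by (simp add: is_core_def young_diagram_def)
next
  case (Cons a q)
  let ?g = "\<lambda>j. j + length (filter (\<lambda>b. b \<le> j) q)"
  have split: "length (filter (\<lambda>b. j < b) q) + length (filter (\<lambda>b. b \<le> j) q) = length q" for j
    using sum_length_filter_compl[of "\<lambda>b. j < b" q] by (simp add: not_less)
  have large: "?g j = j + length q" if "a \<le> j" for j
  proof -
    have "filter (\<lambda>b. b \<le> j) q = q"
      using Cons.prems that by (intro filter_True) auto
    then show ?thesis by simp
  qed
  have "(\<exists>j<a. (a - j) + length (filter (\<lambda>b. j < b) q) = t) \<longleftrightarrow>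
      t \<le> a + length q \<and> (\<exists>j. a + length q - t = ?g j)"
  proof safe
    fix j assume "j < a" and t: "t = (a - j) + length (filter (\<lambda>b. j < b) q)"
    then have *: "a + length q = t + ?g j" using split[of j] by simp
    show "a - j + length (filter ((<) j) q) \<le> a + length q" using split[of j] by linarith
    show "\<exists>ja. a + length q - (a - j + length (filter ((<) j) q)) = ?g ja"
      using * t by (intro exI[of _ j]) linarith
  next
    fix j assume t: "t \<le> a + length q" "a + length q - t = ?g j"
    then have "j < a" using large[of j] assms(2) by (cases "j < a") auto
    moreover have "(a - j) + length (filter (\<lambda>b. j < b) q) = t"
      using t split[of j] \<open>j < a\<close> by linarith
    ultimately show "\<exists>j<a. (a - j) + length (filter (\<lambda>b. j < b) q) = t" by blast
  qed
  also have "(\<exists>j. a + length q - t = ?g j) \<longleftrightarrow> a + length q - t \<in> range ?g"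
    by blast
  also have "\<dots> \<longleftrightarrow> a + length q - t \<notin> beta_set q"
    using range_gaps[of q] Cons.prems by auto
  finally have row: "(\<forall>j<a. (a - j) + length (filter (\<lambda>b. j < b) q) \<noteq> t) \<longleftrightarrow>
      (t \<le> a + length q \<longrightarrow> a + length q - t \<in> beta_set q)"
    by blast
  have "x - t \<noteq> a + length q" if "x \<in> beta_set q" for x
    using beta_set_less[OF Cons.prems that] by simp
  moreover have "a + length q - t \<noteq> a + length q" if "t \<le> a + length q"
    using assms(2) that by simp
  ultimately show ?case
    using Cons row by (auto simp: is_core_Cons)
qed

lemma finite_beta_set: "finite (beta_set p)"
  by (induction p) auto

lemma card_beta_set: "sorted_wrt (\<ge>) p \<Longrightarrow> card (beta_set p) = length p"
proof (induction p)
  case (Cons a q)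
  then have "a + length q \<notin> beta_set q" using beta_set_less[of a q] by blast
  then show ?case using Cons by (simp add: finite_beta_set)
qed simp

text \<open>The beta-numbers are the parts plus \<open>0, 1, \<dots>, length p - 1\<close>; the identity is doubled and rearranged
  to stay within the natural numbers.\<close>

lemma sum_beta_set:
  "sorted_wrt (\<ge>) p \<Longrightarrow> 2 * \<Sum>(beta_set p) + length p = 2 * sum_list p + length p * length p"
proof (induction p)
  case (Cons a q)
  then have "a + length q \<notin> beta_set q" using beta_set_less[of a q] by blast
  then show ?case using Cons by (simp add: finite_beta_set algebra_simps)
qed simp

lemma beta_set_inject:
  assumes "sorted_wrt (\<ge>) p" "sorted_wrt (\<ge>) q" "beta_set p = beta_set q"
  shows "p = q"
  using assms
proof (induction p arbitrary: q)
  case Nil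
  then show ?case by (cases q) auto
next
  case (Cons a p)
  obtain b q' where q: "q = b # q'" using Cons.prems by (cases q) auto
  have len: "length p = length q'"
    using card_beta_set[OF Cons.prems(1)] card_beta_set[OF Cons.prems(2)] Cons.prems(3) q by simp
  have p: "a + length p \<notin> beta_set p" "\<And>x. x \<in> beta_set p \<Longrightarrow> x < a + length p"
    using beta_set_less[of a p] Cons.prems(1) by blast+
  have q': "b + length q' \<notin> beta_set q'" "\<And>x. x \<in> beta_set q' \<Longrightarrow> x < b + length q'"
    using beta_set_less[of b q'] Cons.prems(2) q by blast+
  have eq: "insert (a + length p) (beta_set p) = insert (b + length q') (beta_set q')"
    using Cons.prems(3) q by simp
  have "a + length p = b + length q'"
  proof (rule antisym)
    show "a + length p \<le> b + length q'" using eq q'(2) by (metis insertE insertI1 less_imp_le order_refl)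
    show "b + length q' \<le> a + length p" using eq p(2) by (metis insertE insertI1 less_imp_le order_refl)
  qed
  moreover from this have "beta_set p = beta_set q'"
    using eq p(1) q'(1) by (simp add: insert_ident)
  ultimately show ?case using Cons.IH[of q'] Cons.prems q len by simp
qed

lemma zero_in_beta_set: "sorted_wrt (\<ge>) p \<Longrightarrow> 0 \<in> beta_set p \<longleftrightarrow> 0 \<in> set p"
proof (induction p)
  case (Cons a p)
  then show ?case by (cases p) auto
qed simp

text \<open>The list is built by adding the elements of \<open>X\<close> in increasing order, as new first rows.\<close>

lemma beta_set_surj:
  fixes X :: "nat set"
  assumes "finite X"
  shows "\<exists>p. sorted_wrt (\<ge>) p \<and> beta_set p = X"
  using assms
proof (induction X rule: finite_linorder_max_induct)
  case empty
  show ?case by (rule exI[of _ "[]"]) simp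
next
  case (insert m X)
  then obtain q where q: "sorted_wrt (\<ge>) q" "beta_set q = X" by blast
  have "length q \<le> m"
    using card_beta_set[OF q(1)] q(2) insert.hyps(2) card_mono[of "{..<m}" X] by auto
  moreover have "b \<le> m - length q" if "b \<in> set q" for b
  proof (cases q)
    case Nil
    then show ?thesis using that by simp
  next
    case (Cons c r)
    then have "c + length r < m" using q insert.hyps(2) by auto
    moreover have "b \<le> c" using that Cons q(1) by auto
    ultimately show ?thesis using Cons by simp
  qed
  ultimately have "sorted_wrt (\<ge>) ((m - length q) # q)" "beta_set ((m - length q) # q) = insert m X"
    using q by simp_all
  then show ?case by blast
qed

text \<open>James's abacus with three runners: \<open>a\<close> beads pushed to the top of runner 1, \<open>b\<close> beads pushed to
  the top of runner 2, and none on runner 0, because 0 is not a first column hook length.\<close>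

definition abacus :: "nat \<times> nat \<Rightarrow> nat set" where
  "abacus = (\<lambda>(a, b). (\<lambda>i. 3 * i + 1) ` {..<a} \<union> (\<lambda>i. 3 * i + 2) ` {..<b})"

lemma card_abacus: "card (abacus (a, b)) = a + b"
proof -
  have "(\<lambda>i. 3 * i + 1) ` {..<a} \<inter> (\<lambda>i. 3 * i + 2) ` {..<b} = {}"
    by (auto; presburger)
  then show ?thesis
    unfolding abacus_def by (simp add: card_Un_disjoint card_image inj_on_def)
qed

lemma sum_abacus: "2 * \<Sum>(abacus (a, b)) + a = 3 * a * a + 3 * b * b + b"
proof -
  have "(\<lambda>i. 3 * i + 1) ` {..<a} \<inter> (\<lambda>i. 3 * i + 2) ` {..<b} = {}"
    by (auto; presburger)
  then have "\<Sum>(abacus (a, b)) = (\<Sum>i<a. 3 * i + 1) + (\<Sum>i<b. 3 * i + 2)"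
    unfolding abacus_def
    by (simp add: sum.union_disjoint sum.reindex inj_on_def del: sum.lessThan_Suc)
  moreover have "2 * (\<Sum>i<a. 3 * i + 1) + a = 3 * a * a"
    by (induction a) (auto simp: algebra_simps)
  moreover have "2 * (\<Sum>i<b. 3 * i + 2) = 3 * b * b + b"
    by (induction b) (auto simp: algebra_simps)
  ultimately show ?thesis by simp
qed

lemma mem_abacus_iff:
  "x \<in> abacus (a, b) \<longleftrightarrow> x mod 3 = 1 \<and> x div 3 < a \<or> x mod 3 = 2 \<and> x div 3 < b"
proof -
  have "x \<in> abacus (a, b) \<longleftrightarrow> (\<exists>i<a. x = 3 * i + 1) \<or> (\<exists>i<b. x = 3 * i + 2)"
    by (auto simp: abacus_def)
  moreover have "x = 3 * i + 1 \<longleftrightarrow> x mod 3 = 1 \<and> x div 3 = i"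
    "x = 3 * i + 2 \<longleftrightarrow> x mod 3 = 2 \<and> x div 3 = i" for i
    by presburger+
  ultimately show ?thesis by (metis (no_types, lifting))
qed

lemma inj_abacus: "inj abacus"
proof (rule injI)
  fix x y :: "nat \<times> nat" assume *: "abacus x = abacus y"
  obtain a b c d where xy: "x = (a, b)" "y = (c, d)" by (cases x, cases y)
  have mem: "3 * i + 1 \<in> abacus (k, l) \<longleftrightarrow> i < k" "3 * i + 2 \<in> abacus (k, l) \<longleftrightarrow> i < l" for i k l
    unfolding mem_abacus_iff by presburger+
  have "i < a \<longleftrightarrow> i < c" "i < b \<longleftrightarrow> i < d" for i
    using * mem[of i a b] mem[of i c d] unfolding xy by simp_all
  then show "x = y" using xy by (metis less_irrefl linorder_neqE_nat)
qed

lemma down_closed_nat: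
  fixes Y :: "nat set"
  assumes "finite Y" "\<And>i. Suc i \<in> Y \<Longrightarrow> i \<in> Y"
  shows "Y = {..<card Y}"
proof -
  have below: "j \<in> Y" if "i \<in> Y" "j \<le> i" for i j
    using that(2,1) by (induction rule: inc_induct) (use assms(2) in auto)
  obtain m where m: "m \<notin> Y" using assms(1) infinite_UNIV_nat by (metis UNIV_eq_I)
  define l where "l = (LEAST m. m \<notin> Y)"
  have "l \<notin> Y" unfolding l_def using m by (rule LeastI)
  moreover have "i \<in> Y" if "i < l" for i
    using that not_less_Least unfolding l_def by blast
  ultimately have "Y = {..<l}" using below by (metis lessThan_iff not_less subsetI subset_antisym)
  then show ?thesis by simp
qed

lemma abacus_surj:
  assumes "finite X" "0 \<notin> X" "\<forall>x \<in> X. 3 \<le> x \<longrightarrow> x - 3 \<in> X"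
  shows "X \<in> range abacus"
proof -
  define R where "R r = {i. 3 * i + r \<in> X}" for r
  have R: "R r = {..<card (R r)}" for r
  proof (rule down_closed_nat)
    have "inj_on (\<lambda>i. 3 * i + r) A" for A :: "nat set" by (auto simp: inj_on_def)
    then show "finite (R r)"
      unfolding R_def using finite_vimageI[OF assms(1), of "\<lambda>i. 3 * i + r"]
      by (simp add: vimage_def)
  next
    fix i assume "Suc i \<in> R r"
    then show "i \<in> R r" 
      using bspec[OF assms(3), of "3 * Suc i + r"] unfolding R_def by simp
  qed
  have "R 0 = {}"
  proof -
    have "0 \<notin> R 0" using assms(2) by (simp add: R_def)
    then have "card (R 0) = 0" using R[of 0] by (metis lessThan_iff neq0_conv)
    then show ?thesis using R[of 0] by (metis lessThan_0)
  qed
  have "x \<in> X \<longleftrightarrow> x \<in> abacus (card (R 1), card (R 2))" for x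
  proof -
    have X: "x \<in> X \<longleftrightarrow> x div 3 \<in> R (x mod 3)" unfolding R_def by simp
    have R12: "i \<in> R 1 \<longleftrightarrow> i < card (R 1)" "i \<in> R 2 \<longleftrightarrow> i < card (R 2)" for i
      using R[of 1] R[of 2] by blast+
    have "x mod 3 = 0 \<or> x mod 3 = 1 \<or> x mod 3 = 2" by presburger
    then consider "x mod 3 = 0" | "x mod 3 = 1" | "x mod 3 = 2" by metis
    then show ?thesis
      by cases (simp_all only: X mem_abacus_iff R12 \<open>R 0 = {}\<close>, simp_all)
  qed
  then have "X = abacus (card (R 1), card (R 2))" by blast
  then show ?thesis by blast
qed

lemma abacus_core:
  assumes "x \<in> abacus c" "3 \<le> x"
  shows "x - 3 \<in> abacus c"
proof -
  have "(x - 3) mod 3 = x mod 3" "(x - 3) div 3 \<le> x div 3"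
    using assms(2) by (simp_all add: le_mod_geq div_le_mono)
  then show ?thesis using assms(1) by (cases c) (auto simp: mem_abacus_iff)
qed

text \<open>The pairs whose abacus belongs to a partition of \<open>n\<close>, i.e. the solutions of
  \<open>a\<^sup>2 - a b + b\<^sup>2 + b = n\<close>, written without subtraction.\<close>

definition runner_pairs :: "nat \<Rightarrow> (nat \<times> nat) set" where
  "runner_pairs n = {(a, b). a * a + b * b + b = n + a * b}"

lemma num_cores_3: "num_cores 3 n = card (runner_pairs n)"
proof -
  let ?C = "{p. partition_of n p \<and> is_core 3 p}"
  have "inj_on beta_set ?C"
    by (auto simp: inj_on_def partition_of_def intro: beta_set_inject)
  moreover have "beta_set ` ?C = abacus ` runner_pairs n"
  proof (intro equalityI subsetI)
    fix X assume "X \<in> beta_set ` ?C"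
    then obtain p where p: "sorted_wrt (\<ge>) p" "0 \<notin> set p" "sum_list p = n" "is_core 3 p"
        "X = beta_set p"
      by (auto simp: partition_of_def)
    then have "X \<in> range abacus"
      using is_core_iff_beta_set[of p 3]
      by (intro abacus_surj) (simp_all add: finite_beta_set zero_in_beta_set)
    then obtain a b where ab: "X = abacus (a, b)" by force
    have "length p = a + b"
      using card_beta_set[OF p(1)] card_abacus[of a b] p(5) ab by simp
    then have "a * a + b * b + b = n + a * b"
      using sum_beta_set[OF p(1)] sum_abacus[of a b] p(3,5) ab by (simp add: algebra_simps)
    then show "X \<in> abacus ` runner_pairs n"
      unfolding ab runner_pairs_def by blast
  next
    fix X assume "X \<in> abacus ` runner_pairs n"
    then obtain a b where ab: "X = abacus (a, b)" "a * a + b * b + b = n + a * b"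
      unfolding runner_pairs_def by blast
    have fin: "finite X" unfolding ab abacus_def by simp
    have "0 \<notin> X" unfolding ab by (simp add: mem_abacus_iff)
    obtain p where p: "sorted_wrt (\<ge>) p" "beta_set p = X" using beta_set_surj[OF fin] by blast
    have "length p = a + b"
      using card_beta_set[OF p(1)] card_abacus[of a b] p(2) ab by simp
    then have "sum_list p = n"
      using sum_beta_set[OF p(1)] sum_abacus[of a b] p(2) ab by (simp add: algebra_simps)
    moreover have "is_core 3 p"
      using is_core_iff_beta_set[of p 3] p abacus_core ab by simp
    moreover have "0 \<notin> set p" using zero_in_beta_set[OF p(1)] p(2) \<open>0 \<notin> X\<close> by simp
    ultimately have "p \<in> ?C" using p(1) by (simp add: partition_of_def)
    then show "X \<in> beta_set ` ?C" using p(2) by blast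
  qed
  ultimately have "card ?C = card (abacus ` runner_pairs n)"
    by (metis card_image)
  then show ?thesis
    unfolding num_cores_def using inj_abacus by (simp add: card_image inj_on_subset)
qed

section \<open>The Eisenstein integers and their Euclidean division\<close>

text \<open>\<open>Eis x y\<close> stands for \<open>x + y \<omega>\<close>, where \<open>\<omega>\<close> is a primitive third root of unity.\<close>

datatype eisenstein = Eis (e1: int) (e2: int)

instantiation eisenstein :: comm_ring_1
begin
definition "0 = Eis 0 0"
definition "1 = Eis 1 0"
definition "z + w = Eis (e1 z + e1 w) (e2 z + e2 w)"
definition "z - w = Eis (e1 z - e1 w) (e2 z - e2 w)"
definition "- z = Eis (- e1 z) (- e2 z)"
definition "z * w = Eis (e1 z * e1 w - e2 z * e2 w) (e1 z * e2 w + e2 z * e1 w - e2 z * e2 w)"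
instance
  by standard
    (simp_all add: zero_eisenstein_def one_eisenstein_def plus_eisenstein_def
      minus_eisenstein_def uminus_eisenstein_def times_eisenstein_def algebra_simps)
end

lemmas eis_defs = zero_eisenstein_def one_eisenstein_def plus_eisenstein_def
  minus_eisenstein_def uminus_eisenstein_def times_eisenstein_def

lemma of_int_eisenstein: "of_int k = Eis k 0"
proof -
  have "of_nat m = Eis (int m) 0" for m
    by (induction m) (simp_all add: eis_defs)
  then show ?thesis by (cases k rule: int_diff_cases) (simp add: eis_defs)
qed

definition eis_norm :: "eisenstein \<Rightarrow> int" where
  "eis_norm z = e1 z * e1 z - e1 z * e2 z + e2 z * e2 z"

definition eis_cnj :: "eisenstein \<Rightarrow> eisenstein" where
  "eis_cnj z = Eis (e1 z - e2 z) (- e2 z)"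

lemma norm_mult: "eis_norm (z * w) = eis_norm z * eis_norm w"
  by (simp add: eis_norm_def times_eisenstein_def algebra_simps)

lemma mult_conj: "z * eis_cnj z = of_int (eis_norm z)"
  by (simp add: eis_norm_def eis_cnj_def times_eisenstein_def of_int_eisenstein algebra_simps)

lemma norm_of_int: "eis_norm (of_int k) = k * k"
  by (simp add: eis_norm_def of_int_eisenstein)

lemma norm_conj: "eis_norm (eis_cnj z) = eis_norm z"
  by (simp add: eis_norm_def eis_cnj_def algebra_simps)

lemma four_norm: "4 * eis_norm z = (2 * e1 z - e2 z)\<^sup>2 + 3 * (e2 z)\<^sup>2"
  by (simp add: eis_norm_def algebra_simps power2_eq_square)

lemma norm_nonneg: "eis_norm z \<ge> 0"
proof -
  have "4 * eis_norm z \<ge> 0" unfolding four_norm by simp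
  then show ?thesis by simp
qed

lemma norm_eq_0_iff: "eis_norm z = 0 \<longleftrightarrow> z = 0"
proof
  assume "eis_norm z = 0"
  then have *: "(2 * e1 z - e2 z)\<^sup>2 + 3 * (e2 z)\<^sup>2 = 0" using four_norm[of z] by simp
  have "(2 * e1 z - e2 z)\<^sup>2 \<ge> 0" "(e2 z)\<^sup>2 \<ge> 0" by simp_all
  with * have "(2 * e1 z - e2 z)\<^sup>2 = 0" "(e2 z)\<^sup>2 = 0" by linarith+
  then show "z = 0" by (cases z) (simp add: zero_eisenstein_def)
qed (simp add: eis_norm_def zero_eisenstein_def)

lemma nearest_multiple:
  fixes p m :: int
  assumes "m > 0"
  shows "\<exists>q. 2 * \<bar>p - q * m\<bar> \<le> m"
proof (cases "2 * (p mod m) \<le> m")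
  case True
  have "p - (p div m) * m = p mod m" by (simp add: minus_div_mult_eq_mod)
  moreover have "p mod m \<ge> 0" using assms by simp
  ultimately show ?thesis using True by (intro exI[of _ "p div m"]) simp
next
  case False
  have "p - (p div m + 1) * m = p mod m - m" by (simp add: minus_div_mult_eq_mod algebra_simps)
  moreover have "p mod m < m" using assms by simp
  ultimately show ?thesis using False by (intro exI[of _ "p div m + 1"]) simp
qed

lemma norm_le_of_coords:
  assumes "2 * \<bar>e1 z\<bar> \<le> m" "2 * \<bar>e2 z\<bar> \<le> m"
  shows "4 * eis_norm z \<le> 3 * (m * m)"
proof -
  have "(2 * \<bar>e1 z\<bar>) * (2 * \<bar>e1 z\<bar>) \<le> m * m" "(2 * \<bar>e2 z\<bar>) * (2 * \<bar>e2 z\<bar>) \<le> m * m"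
    "(2 * \<bar>e1 z\<bar>) * (2 * \<bar>e2 z\<bar>) \<le> m * m"
    using assms by (intro mult_mono; simp)+
  moreover have "- (\<bar>e1 z\<bar> * \<bar>e2 z\<bar>) \<le> e1 z * e2 z"
    by (metis abs_mult abs_ge_minus_self minus_le_iff)
  ultimately show ?thesis by (simp add: eis_norm_def algebra_simps)
qed

text \<open>The coordinates of \<open>a / b\<close> are rounded to nearest integers. The error has coordinates of absolute
  value at most 1/2, hence norm at most 3/4. Multiplication by the conjugate of \<open>b\<close> clears the
  denominators.\<close>

lemma euclidean_division:
  assumes "b \<noteq> 0"
  shows "\<exists>q. eis_norm (a - q * b) < eis_norm b"
proof -
  let ?m = "eis_norm b"
  have m: "?m > 0" using assms norm_nonneg[of b] norm_eq_0_iff[of b] by linarith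
  obtain q1 q2 where q: "2 * \<bar>e1 (a * eis_cnj b) - q1 * ?m\<bar> \<le> ?m"
      "2 * \<bar>e2 (a * eis_cnj b) - q2 * ?m\<bar> \<le> ?m"
    using nearest_multiple[OF m] by meson
  let ?q = "Eis q1 q2"
  have "(a - ?q * b) * eis_cnj b = a * eis_cnj b - ?q * of_int ?m"
    by (simp add: left_diff_distrib mult.assoc mult_conj)
  also have "\<dots> = Eis (e1 (a * eis_cnj b) - q1 * ?m) (e2 (a * eis_cnj b) - q2 * ?m)"
    by (simp add: of_int_eisenstein minus_eisenstein_def times_eisenstein_def)
  finally have "4 * eis_norm ((a - ?q * b) * eis_cnj b) \<le> 3 * (?m * ?m)"
    using q by (intro norm_le_of_coords) simp_all
  then have "4 * (eis_norm (a - ?q * b) * ?m) \<le> 3 * (?m * ?m)"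
    by (simp add: norm_mult norm_conj)
  then have "(4 * eis_norm (a - ?q * b)) * ?m \<le> (3 * ?m) * ?m" by (simp add: algebra_simps)
  then have "4 * eis_norm (a - ?q * b) \<le> 3 * ?m" using m by (simp only: mult_le_cancel_right_pos)
  then have "eis_norm (a - ?q * b) < ?m" using m by simp
  then show ?thesis by blast
qed

lemma bezout_eisenstein:
  fixes a b :: eisenstein
  assumes "a \<noteq> 0"
  shows "\<exists>x y. x * a + y * b dvd a \<and> x * a + y * b dvd b"
proof -
  \<comment> \<open>An element of least positive norm in the ideal generated by \<open>a\<close> and \<open>b\<close> divides the others.\<close>
  define I where "I = {d. \<exists>x y. d = x * a + y * b}"
  have sub: "c - q * d \<in> I" if cd: "c \<in> I" "d \<in> I" for c d q
  proof -
    obtain x y x' y' where "c = x * a + y * b" "d = x' * a + y' * b"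
      using cd unfolding I_def by blast
    then have "c - q * d = (x - q * x') * a + (y - q * y') * b" by (simp add: algebra_simps)
    then show ?thesis unfolding I_def by blast
  qed
  have "a = 1 * a + 0 * b" "b = 0 * a + 1 * b" by simp_all
  then have ab: "a \<in> I" "b \<in> I" unfolding I_def by blast+
  obtain d where d: "d \<in> I" "d \<noteq> 0" and
      least: "\<And>c. c \<in> I \<Longrightarrow> c \<noteq> 0 \<Longrightarrow> nat (eis_norm d) \<le> nat (eis_norm c)"
    using ex_has_least_nat[of "\<lambda>d. d \<in> I \<and> d \<noteq> 0" a "\<lambda>d. nat (eis_norm d)"] ab assms by blast
  have "d dvd c" if c: "c \<in> I" for c
  proof -
    obtain q where q: "eis_norm (c - q * d) < eis_norm d" using euclidean_division[OF d(2)] by blast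
    then have "c - q * d = 0"
      using least[OF sub[OF c d(1), of q]] norm_nonneg[of "c - q * d"] by (auto simp: nat_le_iff)
    then have "c = d * q" by (simp add: mult.commute)
    then show ?thesis by (rule dvdI)
  qed
  then show ?thesis using d(1) ab unfolding I_def by blast
qed

text \<open>The witness is the trace of \<open>x a\<close> times the conjugate of \<open>y\<close>, plus \<open>m\<close> times the norm of \<open>y\<close>.\<close>

lemma norm_add_multiple:
  "\<exists>k. eis_norm (x * a + y * of_int m) = eis_norm x * eis_norm a + m * k"
  unfolding eis_norm_def of_int_eisenstein plus_eisenstein_def times_eisenstein_def
  by (rule exI[of _ "2 * e1 (x * a) * e1 y - e1 (x * a) * e2 y - e2 (x * a) * e1 y +
      2 * e2 (x * a) * e2 y + m * eis_norm y"])
    (simp add: times_eisenstein_def eis_norm_def algebra_simps)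

lemma norm_dvd: "a dvd b \<Longrightarrow> eis_norm a dvd eis_norm b"
  by (auto simp: dvd_def norm_mult)

text \<open>The factor \<open>\<delta>\<close> is a greatest common divisor of \<open>\<gamma>\<close> and \<open>m\<close>. Its norm is a multiple of \<open>m\<close>, since
  \<open>\<delta>\<close> is congruent modulo \<open>m\<close> to a multiple of \<open>\<gamma>\<close>, and it divides both \<open>m m'\<close> and \<open>m\<^sup>2\<close>, whose
  greatest common divisor is \<open>m\<close>.\<close>

lemma factor_of_coprime_norm:
  assumes "eis_norm \<gamma> = m * m'" "coprime m m'" "m > 0" "\<gamma> \<noteq> 0"
  shows "\<exists>\<delta> \<epsilon>. \<gamma> = \<delta> * \<epsilon> \<and> eis_norm \<delta> = m \<and> eis_norm \<epsilon> = m'"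
proof -
  obtain x y where dvd: "x * \<gamma> + y * of_int m dvd \<gamma>" "x * \<gamma> + y * of_int m dvd of_int m"
    using bezout_eisenstein[OF assms(4)] by blast
  define \<delta> where "\<delta> = x * \<gamma> + y * of_int m"
  obtain k where "eis_norm \<delta> = eis_norm x * (m * m') + m * k"
    using norm_add_multiple[of x \<gamma> y m] assms(1) unfolding \<delta>_def by auto
  then have "eis_norm \<delta> = m * (eis_norm x * m' + k)" by (simp add: algebra_simps)
  then obtain t where t: "eis_norm \<delta> = m * t" by blast
  have "m * t dvd m * m'" "m * t dvd m * m"
    using norm_dvd[OF dvd(1)] norm_dvd[OF dvd(2)] assms(1) t
    unfolding \<delta>_def by (simp_all add: norm_of_int)
  then have "t dvd m'" "t dvd m" using assms(3) by simp_all
  then have "is_unit t" using assms(2) by (meson coprime_common_divisor)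
  moreover have "t \<ge> 0" using t norm_nonneg[of \<delta>] assms(3) by (simp add: zero_le_mult_iff)
  ultimately have "eis_norm \<delta> = m" using t by simp
  moreover obtain \<epsilon> where "\<gamma> = \<delta> * \<epsilon>" using dvd(1) unfolding \<delta>_def by (auto simp: dvd_def)
  moreover from calculation have "eis_norm \<epsilon> = m'"
    using assms(1,3) by (simp add: norm_mult)
  ultimately show ?thesis by blast
qed

definition primary :: "eisenstein \<Rightarrow> bool" where
  "primary z \<longleftrightarrow> e1 z mod 3 = 1 \<and> e2 z mod 3 = 0"

lemma primary_mult_iff:
  assumes "primary a"
  shows "primary (a * z) \<longleftrightarrow> primary z"
proof -
  define p q where "p = e1 a div 3" and "q = e2 a div 3"
  have a: "e1 a = 1 + 3 * p" "e2 a = 3 * q"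
    using assms unfolding primary_def p_def q_def by presburger+
  have "e1 (a * z) = e1 z + 3 * (p * e1 z - q * e2 z)"
    "e2 (a * z) = e2 z + 3 * (p * e2 z + q * e1 z - q * e2 z)"
    by (simp_all add: times_eisenstein_def a algebra_simps)
  then show ?thesis unfolding primary_def by presburger
qed

lemma primary_unit:
  assumes "primary u" "eis_norm u = 1"
  shows "u = 1"
proof -
  have *: "(2 * e1 u - e2 u)\<^sup>2 + 3 * (e2 u)\<^sup>2 = 4" using four_norm[of u] assms(2) by simp
  have "e2 u = 0"
  proof (rule ccontr)
    assume "e2 u \<noteq> 0"
    then have "\<bar>e2 u\<bar> \<ge> 3" using assms(1) unfolding primary_def by presburger
    then have "\<bar>3\<bar> \<le> \<bar>e2 u\<bar>" by simp
    then have "9 \<le> (e2 u)\<^sup>2" unfolding abs_le_square_iff by simp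
    then show False using * zero_le_power2[of "2 * e1 u - e2 u"] by linarith
  qed
  then have "(e1 u)\<^sup>2 = 1\<^sup>2" using * by (simp add: power_mult_distrib)
  then have "e1 u = 1" using assms(1) unfolding primary_def power2_eq_iff by auto
  then show ?thesis using \<open>e2 u = 0\<close> by (cases u) (simp add: one_eisenstein_def)
qed

lemma norm_mod_3: "[eis_norm z = (e1 z + e2 z)\<^sup>2] (mod 3)"
proof -
  have "(e1 z + e2 z)\<^sup>2 = eis_norm z + 3 * (e1 z * e2 z)"
    by (simp add: eis_norm_def power2_eq_square algebra_simps)
  then show ?thesis by (simp add: cong_def)
qed

text \<open>The six units represent the six invertible residue classes modulo 3.\<close>

lemma primary_associate:
  assumes "\<not> 3 dvd eis_norm z"
  shows "\<exists>u. eis_norm u = 1 \<and> primary (z * u)"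
proof -
  have "\<not> 3 dvd (e1 z + e2 z)\<^sup>2"
    using assms norm_mod_3[of z] by (meson cong_dvd_iff)
  then have ndvd: "\<not> 3 dvd e1 z + e2 z" by (metis dvd_mult power2_eq_square)
  obtain x y where z: "z = Eis x y" by (cases z)
  have "\<not> 3 dvd x + y" using ndvd z by simp
  have unit: ?thesis if "eis_norm (Eis u v) = 1" "(x * u - y * v) mod 3 = 1"
    "(x * v + y * u - y * v) mod 3 = 0" for u v
    using that unfolding z by (intro exI[of _ "Eis u v"]) (simp add: primary_def times_eisenstein_def)
  have "x mod 3 = 1 \<and> y mod 3 = 0 \<or> x mod 3 = 2 \<and> y mod 3 = 0 \<or>
      x mod 3 = 0 \<and> y mod 3 = 1 \<or> x mod 3 = 0 \<and> y mod 3 = 2 \<or>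
      x mod 3 = 1 \<and> y mod 3 = 1 \<or> x mod 3 = 2 \<and> y mod 3 = 2"
    using \<open>\<not> 3 dvd x + y\<close> by presburger
  then show ?thesis
  proof (elim disjE conjE)
    assume "x mod 3 = 1" "y mod 3 = 0"
    then show ?thesis by (intro unit[of 1 0]) (simp_all add: eis_norm_def)
  next
    assume "x mod 3 = 2" "y mod 3 = 0"
    then show ?thesis by (intro unit[of "-1" 0]; simp add: eis_norm_def; presburger)
  next
    assume "x mod 3 = 0" "y mod 3 = 1"
    then show ?thesis by (intro unit[of "-1" "-1"]; simp add: eis_norm_def; presburger)
  next
    assume "x mod 3 = 0" "y mod 3 = 2"
    then show ?thesis by (intro unit[of 1 1]; simp add: eis_norm_def; presburger)
  next
    assume "x mod 3 = 1" "y mod 3 = 1"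
    then show ?thesis by (intro unit[of 0 "-1"]; simp add: eis_norm_def; presburger)
  next
    assume "x mod 3 = 2" "y mod 3 = 2"
    then show ?thesis by (intro unit[of 0 1]; simp add: eis_norm_def; presburger)
  qed
qed

definition primaries :: "int \<Rightarrow> eisenstein set" where
  "primaries m = {z. primary z \<and> eis_norm z = m}"

text \<open>Since \<open>1 = s m + t m'\<close> with \<open>m = \<alpha> eis_cnj \<alpha>\<close> and \<open>m' = \<beta>' eis_cnj \<beta>'\<close>, the element \<open>\<alpha>'\<close> is a combination of
  \<open>\<alpha>\<close> and \<open>\<alpha>' \<beta>' = \<alpha> \<beta>\<close>, hence a multiple of \<open>\<alpha>\<close>. The quotient has norm 1 and is primary.\<close>

lemma primary_factor_unique:
  assumes eq: "\<alpha> * \<beta> = \<alpha>' * \<beta>'"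
    and \<alpha>: "\<alpha> \<in> primaries m" "\<alpha>' \<in> primaries m"
    and \<beta>': "eis_norm \<beta>' = m'" and cop: "coprime m m'" and "m > 0"
  shows "\<alpha> = \<alpha>'"
proof -
  obtain s t where "s * m + t * m' = 1" using cop by (metis bezout_int coprime_iff_gcd_eq_1)
  then have st: "(of_int s * of_int m + of_int t * of_int m' :: eisenstein) = 1"
    by (metis of_int_add of_int_mult of_int_1)
  have "\<alpha>' = (of_int s * of_int m + of_int t * of_int m') * \<alpha>'" using st by simp
  also have "\<dots> = of_int s * (\<alpha> * eis_cnj \<alpha>) * \<alpha>' + of_int t * (\<beta>' * eis_cnj \<beta>') * \<alpha>'"
    using \<alpha> \<beta>' by (simp add: mult_conj primaries_def algebra_simps)
  also have "\<dots> = \<alpha> * (of_int s * eis_cnj \<alpha> * \<alpha>') + of_int t * eis_cnj \<beta>' * (\<alpha>' * \<beta>')"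
    by (simp add: algebra_simps)
  also have "\<dots> = \<alpha> * (of_int s * eis_cnj \<alpha> * \<alpha>' + of_int t * eis_cnj \<beta>' * \<beta>)"
    by (simp add: eq[symmetric] algebra_simps)
  finally obtain \<epsilon> where \<epsilon>: "\<alpha>' = \<alpha> * \<epsilon>" by blast
  then have "primary \<epsilon>" using \<alpha> primary_mult_iff unfolding primaries_def by blast
  moreover have "m = m * eis_norm \<epsilon>" using \<epsilon> \<alpha> norm_mult[of \<alpha> \<epsilon>] by (simp add: primaries_def)
  then have "eis_norm \<epsilon> = 1" using \<open>m > 0\<close> by simp
  ultimately have "\<epsilon> = 1" by (rule primary_unit)
  then show ?thesis using \<epsilon> by simp
qed

lemma card_primaries_mult:
  assumes "coprime m m'" "m > 0" "m' > 0"
  shows "card (primaries (m * m')) = card (primaries m) * card (primaries m')"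
proof -
  have "bij_betw (\<lambda>(\<alpha>, \<beta>). \<alpha> * \<beta>) (primaries m \<times> primaries m') (primaries (m * m'))"
    unfolding bij_betw_def
  proof (intro conjI inj_onI equalityI subsetI)
    fix p p' assume p: "p \<in> primaries m \<times> primaries m'" "p' \<in> primaries m \<times> primaries m'"
      and "(\<lambda>(\<alpha>, \<beta>). \<alpha> * \<beta>) p = (\<lambda>(\<alpha>, \<beta>). \<alpha> * \<beta>) p'"
    then obtain \<alpha> \<beta> \<alpha>' \<beta>' where *: "p = (\<alpha>, \<beta>)" "p' = (\<alpha>', \<beta>')" "\<alpha> * \<beta> = \<alpha>' * \<beta>'"
      by (cases p, cases p') auto
    have "\<alpha> = \<alpha>'"
      using primary_factor_unique[OF *(3), of m m'] p * assms by (auto simp: primaries_def)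
    moreover have "\<beta> * \<alpha> = \<beta>' * \<alpha>'" using *(3) by (simp add: mult.commute)
    then have "\<beta> = \<beta>'"
      using primary_factor_unique[of \<beta> \<alpha> \<beta>' \<alpha>' m' m] p * assms
      by (auto simp: primaries_def coprime_commute)
    ultimately show "p = p'" using * by simp
  next
    fix \<gamma> assume "\<gamma> \<in> (\<lambda>(\<alpha>, \<beta>). \<alpha> * \<beta>) ` (primaries m \<times> primaries m')"
    then show "\<gamma> \<in> primaries (m * m')"
      by (auto simp: primaries_def norm_mult primary_mult_iff)
  next
    fix \<gamma> assume "\<gamma> \<in> primaries (m * m')"
    then have \<gamma>: "primary \<gamma>" "eis_norm \<gamma> = m * m'" by (simp_all add: primaries_def)
    then have "\<gamma> \<noteq> 0" by (auto simp: primary_def zero_eisenstein_def)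
    then obtain \<delta> \<epsilon> where \<delta>: "\<gamma> = \<delta> * \<epsilon>" "eis_norm \<delta> = m" "eis_norm \<epsilon> = m'"
      using factor_of_coprime_norm \<gamma>(2) assms by blast
    have "e1 \<gamma> + e2 \<gamma> = 1 + 3 * ((e1 \<gamma> + e2 \<gamma>) div 3)"
      using \<gamma>(1) unfolding primary_def by presburger
    then have "[(e1 \<gamma> + e2 \<gamma>) = 1] (mod 3)" by (metis cong_def mod_mult_self2)
    then have "[eis_norm \<gamma> = 1\<^sup>2] (mod 3)" using norm_mod_3[of \<gamma>] by (meson cong_pow cong_trans)
    then have "\<not> 3 dvd eis_norm \<gamma>" by (auto simp: cong_def)
    then have "\<not> 3 dvd eis_norm \<delta>" using \<gamma> \<delta> by auto
    then obtain u where u: "eis_norm u = 1" "primary (\<delta> * u)" using primary_associate by blast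
    \<comment> \<open>The inverse of the unit \<open>u\<close> is its conjugate; it is moved to the other factor.\<close>
    have "\<gamma> = \<delta> * \<epsilon> * (u * eis_cnj u)" using \<delta>(1) u(1) by (simp add: mult_conj)
    also have "\<dots> = (\<delta> * u) * (eis_cnj u * \<epsilon>)" by (simp add: algebra_simps)
    finally have split: "\<gamma> = (\<delta> * u) * (eis_cnj u * \<epsilon>)" .
    then have "primary (eis_cnj u * \<epsilon>)" using \<gamma>(1) u(2) primary_mult_iff by blast
    then have "(\<delta> * u, eis_cnj u * \<epsilon>) \<in> primaries m \<times> primaries m'"
      using u \<delta> by (simp add: primaries_def norm_mult norm_conj)
    then show "\<gamma> \<in> (\<lambda>(\<alpha>, \<beta>). \<alpha> * \<beta>) ` (primaries m \<times> primaries m')"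
      using split by force
  qed
  then show ?thesis using bij_betw_same_card card_cartesian_product by metis
qed

section \<open>From pairs of natural numbers to primary elements\<close>

text \<open>The second factor is \<open>z = 1 - \<omega> (1 - \<omega>) (a + b \<omega>)\<close>. Modulo 3 it is congruent to \<open>\<omega> ^ (a + b)\<close>, and so
  \<open>\<omega> ^ (2 (a + b)) z\<close> is its primary associate.\<close>

definition primary_of_pair :: "nat \<times> nat \<Rightarrow> eisenstein" where
  "primary_of_pair = (\<lambda>(a, b). (Eis 0 1) ^ (2 * (a + b)) * Eis (2 * int b - int a + 1) (int b - 2 * int a))"

lemma omega_power:
  "Eis 0 1 ^ (2 * s) = (if s mod 3 = 0 then Eis 1 0 else if s mod 3 = 1 then Eis (-1) (-1) else Eis 0 1)"
proof (induction s)
  case (Suc s)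
  have "Eis 0 1 ^ (2 * Suc s) = Eis (-1) (-1) * Eis 0 1 ^ (2 * s)"
    by (simp add: power_add power2_eq_square times_eisenstein_def mult.assoc)
  then show ?case using Suc by (auto simp: mod_Suc times_eisenstein_def)
qed (simp add: one_eisenstein_def)

lemma primary_of_pair_eq:
  "primary_of_pair (a, b) =
    (if (a + b) mod 3 = 0 then Eis (2 * int b - int a + 1) (int b - 2 * int a)
     else if (a + b) mod 3 = 1 then Eis (- int a - int b - 1) (int a - 2 * int b - 1)
     else Eis (2 * int a - int b) (int a + int b + 1))"
  unfolding primary_of_pair_def prod.case omega_power by (simp add: times_eisenstein_def)

lemma norm_primary_of_pair:
  "eis_norm (primary_of_pair (a, b)) = 3 * (int a * int a - int a * int b + int b * int b + int b) + 1"
  by (simp add: primary_of_pair_eq eis_norm_def algebra_simps)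

lemma mod_3_eqI: "int s = 3 * t + int r \<Longrightarrow> r < 3 \<Longrightarrow> s mod 3 = r"
  by presburger

text \<open>The elements \<open>z\<close> above with integers \<open>a\<close>, \<open>b\<close> are all those congruent to 1 modulo \<open>1 - \<omega>\<close>. The
  conditions \<open>a \<ge> 0\<close>, \<open>b \<ge> 0\<close> cut out a sector that contains exactly one of \<open>z\<close>, \<open>\<omega> z\<close>, \<open>\<omega>\<^sup>2 z\<close>, and
  exactly one of these three is primary.\<close>

lemma bij_primary_of_pair: "bij_betw primary_of_pair UNIV {z. primary z}"
  unfolding bij_betw_def
proof (intro conjI injI equalityI subsetI)
  fix p q assume *: "primary_of_pair p = primary_of_pair q"
  obtain a b c d where pq: "p = (a, b)" "q = (c, d)" by (cases p, cases q)
  have "a = c \<and> b = d"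
    using * unfolding pq primary_of_pair_eq by (simp split: if_splits)
  then show "p = q" using pq by simp
next
  fix z assume "z \<in> range primary_of_pair"
  then obtain a b where z: "z = primary_of_pair (a, b)" by force
  define k where "k = int ((a + b) div 3)"
  have s: "int a + int b = 3 * k + int ((a + b) mod 3)"
    unfolding k_def by presburger
  have "(a + b) mod 3 = 0 \<or> (a + b) mod 3 = 1 \<or> (a + b) mod 3 = 2" by presburger
  then consider "(a + b) mod 3 = 0" | "(a + b) mod 3 = 1" | "(a + b) mod 3 = 2" by metis
  then have "primary z"
  proof cases
    case 1
    then have "int a = 3 * k - int b" using s by simp
    then show ?thesis unfolding z primary_of_pair_eq primary_def using 1 by (simp; presburger)
  next
    case 2
    then have "int a = 3 * k + 1 - int b" using s by simp
    then show ?thesis unfolding z primary_of_pair_eq primary_def using 2 by (simp; presburger)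
  next
    case 3
    then have "int a = 3 * k + 2 - int b" using s by simp
    then show ?thesis unfolding z primary_of_pair_eq primary_def using 3 by (simp; presburger)
  qed
  then show "z \<in> {z. primary z}" by simp
next
  fix z assume "z \<in> {z. primary z}"
  then have m: "e1 z mod 3 = 1" "e2 z mod 3 = 0" by (simp_all add: primary_def)
  define x y where "x = e1 z div 3" and "y = e2 z div 3"
  have z: "z = Eis (3 * x + 1) (3 * y)"
    using m unfolding x_def y_def by (cases z) (simp; presburger)
  \<comment> \<open>The three sectors of the plane: the cases \<open>z\<close>, \<open>\<omega> z\<close> and \<open>\<omega>\<^sup>2 z\<close> for \<open>z\<close> in the first sector.\<close>
  consider "x \<ge> 2 * y" "2 * x \<ge> y" | "x + y \<ge> 0" "2 * y \<ge> x + 1" | "y \<ge> 2 * x + 1" "x + y + 1 \<le> 0"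
    by linarith
  then have "\<exists>a b. primary_of_pair (a, b) = z"
  proof cases
    case 1
    then have "(nat (x - 2 * y) + nat (2 * x - y)) mod 3 = 0"
      by (intro mod_3_eqI[of _ "x - y"]) simp_all
    with 1 have "primary_of_pair (nat (x - 2 * y), nat (2 * x - y)) = z"
      unfolding primary_of_pair_eq z by simp
    then show ?thesis by blast
  next
    case 2
    then have "(nat (x + y) + nat (2 * y - x - 1)) mod 3 = 2"
      by (intro mod_3_eqI[of _ "y - 1"]) simp_all
    with 2 have "primary_of_pair (nat (x + y), nat (2 * y - x - 1)) = z"
      unfolding primary_of_pair_eq z by simp
    then show ?thesis by blast
  next
    case 3
    then have "(nat (y - 2 * x - 1) + nat (- x - y - 1)) mod 3 = 1"
      by (intro mod_3_eqI[of _ "- x - 1"]) simp_all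
    with 3 have "primary_of_pair (nat (y - 2 * x - 1), nat (- x - y - 1)) = z"
      unfolding primary_of_pair_eq z by simp
    then show ?thesis by blast
  qed
  then show "z \<in> range primary_of_pair" by (metis rangeI)
qed

lemma card_runner_pairs: "card (runner_pairs n) = card (primaries (3 * int n + 1))"
proof (rule bij_betw_same_card[of primary_of_pair])
  have iff: "p \<in> runner_pairs n \<longleftrightarrow> eis_norm (primary_of_pair p) = 3 * int n + 1" for p
  proof -
    obtain a b where p: "p = (a, b)" by (cases p)
    have "a * a + b * b + b = n + a * b \<longleftrightarrow> int (a * a + b * b + b) = int (n + a * b)"
      by (simp only: of_nat_eq_iff)
    then show ?thesis unfolding p runner_pairs_def norm_primary_of_pair
      by (simp; linarith)
  qed
  show "bij_betw primary_of_pair (runner_pairs n) (primaries (3 * int n + 1))"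
  proof (rule bij_betw_subset[OF bij_primary_of_pair])
    have "z \<in> range primary_of_pair" if "primary z" for z
      using that bij_primary_of_pair unfolding bij_betw_def by blast
    moreover have "primary (primary_of_pair p)" for p
      using bij_primary_of_pair unfolding bij_betw_def by blast
    ultimately show "primary_of_pair ` runner_pairs n = primaries (3 * int n + 1)"
      unfolding primaries_def using iff by fast
  qed simp
qed

section \<open>The product formula\<close>

lemma coprime_norms: "coprime (3 * int n + 1) (3 * int (n + 3 ^ k) + 1)"
proof -
  have "coprime (3 * int n + 1) 3"
    by (rule coprimeI) (metis dvd_add_right_iff dvd_mult2)
  then have "coprime (3 * int n + 1) (3 ^ Suc k)" by (simp add: coprime_power_right_iff del: power_Suc)
  moreover have "3 * int (n + 3 ^ k) + 1 = (3 * int n + 1) + 3 ^ Suc k" by simp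
  ultimately show ?thesis by (simp only: coprime_iff_gcd_eq_1 gcd_add2)
qed

theorem mainTheorem4:
  fixes n k :: nat
  assumes "n \<ge> 1"
  shows "num_cores 3 (3 * n ^ 2 + (3 ^ (k + 1) + 2) * n + 3 ^ k) =
    num_cores 3 n * num_cores 3 (n + 3 ^ k)"
proof -
  let ?N = "3 * n ^ 2 + (3 ^ (k + 1) + 2) * n + 3 ^ k"
  have "3 * int ?N + 1 = (3 * int n + 1) * (3 * int (n + 3 ^ k) + 1)"
    by (simp add: algebra_simps power2_eq_square)
  then have "num_cores 3 ?N = card (primaries ((3 * int n + 1) * (3 * int (n + 3 ^ k) + 1)))"
    by (simp only: num_cores_3 card_runner_pairs)
  also have "\<dots> = card (primaries (3 * int n + 1)) * card (primaries (3 * int (n + 3 ^ k) + 1))"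
    by (intro card_primaries_mult coprime_norms) simp_all
  finally show ?thesis by (simp only: num_cores_3 card_runner_pairs)
qed

end
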